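(* Let $q$ be a prime power, let $k\geq 2$ be an integer, and suppose $n=s+t$, where $s$ is a positive integer divisible by $k+1$ and $t$ is an integer with $0<t<k+1$. Fix an $s$-dimensional subspace $V(s,q)$ of $V(n,q)$. Let $\mathcal{P}=\mathcal{S}\cup\mathcal{T}$ be a partition of the non-zero vectors of $V(n,q)$ into (the sets of non-zero vectors of) subspaces, where $\mathcal{S}=\{W_1,\ldots,W_m\}$ is a $(k+1)$-spread of $V(s,q)$ and $\mathcal{T}=\{X_1,\ldots,X_\ell\}$ consists of $t$-dimensional subspaces of $V(n,q)$ whose non-zero vectors partition $V(n,q)\setminus V(s,q)$. Let $Z$ be a fixed $(k-t+1)$-dimensional subspace of $V(s,q)$. Let \[ \mathcal{M} = \bigcup_{i=1}^m \{U\leq W_i \, : \, \dim(U)=k \} \cup \bigcup_{j=1}^\ell \{ U \leq X_j \oplus Z \, : \, \dim(U)=k\}. \] Then $\mathcal{M}$ is a resolving set for the Grassmann graph $G_q(n,k)$, of size at most ${(n-t)+(k+1) \brack 1}_q=\frac{q^{(n-t)+(k+1)}-1}{q-1}$.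
   Context: $V(n,q)$ denotes the $n$-dimensional vector space over the finite field $\mathbb{F}_q$; $U\leq W$ means that $U$ is a subspace of $W$. The Grassmann graph $G_q(n,k)$ has as its vertex set the set of all $k$-dimensional subspaces of $V(n,q)$; two vertices are adjacent if the corresponding subspaces intersect in a subspace of dimension $k-1$. (The graph distance between vertices $X$ and $Y$ is $k-\dim(X\cap Y)$.) A resolving set for a graph $\Gamma=(V,E)$ is a set of vertices $S=\{v_1,\ldots,v_r\}$ such that for all $u,w\in V$, the lists of graph distances $(d(u,v_1),\ldots,d(u,v_r))$ and $(d(w,v_1),\ldots,d(w,v_r))$ are equal if and only if $u=w$. A $(k+1)$-spread of an $\mathbb{F}_q$-vector space $V$ is a collection of $(k+1)$-dimensional subspaces $\{W_1,\ldots,W_m\}$ of $V$ such that (i) any non-zero vector of $V$ belongs to exactly one $W_i$; and (ii) if $i\neq j$, then $W_i\cap W_j=\{0\}$. Each $X_j$ meets $V(s,q)$ only in $0$, so the sum $X_j+Z$ is direct; $X_j\oplus Z$ denotes this $(k+1)$-dimensional subspace of $V(n,q)$. The Gaussian binomial coefficient is ${N \brack 1}_q=\frac{q^N-1}{q-1}$. *)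

theory Defs
  imports "HOL-Analysis.Analysis" "Graph_Theory.Graph_Theory"
begin

text \<open>
  The space $V(n,q)$ is the type \<open>'a ^ 'n\<close> with \<open>'a\<close> a finite field, \<open>q = CARD('a)\<close> and
  \<open>n = CARD('n)\<close>; its subspaces and their dimensions are \<open>vec.subspace\<close> and \<open>vec.dim\<close>.
\<close>

definition subspaces_of_dim :: "nat \<Rightarrow> ('a::field ^ 'n) set \<Rightarrow> ('a ^ 'n) set set" where
  "subspaces_of_dim d W = {U. vec.subspace U \<and> U \<subseteq> W \<and> vec.dim U = d}"

text \<open>
  An undirected graph is represented by its symmetric arc relation.  Adjacency is written
  as \<open>dim (X \<inter> Y) + 1 = k\<close> to avoid truncated subtraction; for vertices of dimension \<open>k\<close> it
  excludes \<open>X = Y\<close>.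
\<close>

definition grassmann_graph :: "nat \<Rightarrow> ('a::field ^ 'n) set pair_pre_digraph" where
  "grassmann_graph k =
    \<lparr> pverts = subspaces_of_dim k UNIV,
      parcs = {(X, Y). X \<in> subspaces_of_dim k UNIV \<and> Y \<in> subspaces_of_dim k UNIV
                 \<and> vec.dim (X \<inter> Y) + 1 = k} \<rparr>"

lemma pair_graph_grassmann_graph:
  "pair_graph (grassmann_graph k :: ('a::{field,finite} ^ 'n) set pair_pre_digraph)"
proof -
  define G where "G = (grassmann_graph k :: ('a ^ 'n) set pair_pre_digraph)"
  have adj: "e \<in> parcs G \<longleftrightarrow> fst e \<in> pverts G \<and> snd e \<in> pverts G
      \<and> vec.dim (fst e \<inter> snd e) + 1 = k" for e
    by (cases e) (simp add: G_def grassmann_graph_def)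
  have dim: "vec.dim U = k" if "U \<in> pverts G" for U
    using that by (simp add: G_def grassmann_graph_def subspaces_of_dim_def)
  have "pair_graph G"
  proof
    show "fst e \<noteq> snd e" if "e \<in> parcs G" for e
    proof
      assume "fst e = snd e"
      then show False
        using that adj[of e] dim[of "snd e"] by simp
    qed
    show "symmetric (with_proj G)"
      unfolding symmetric_def with_proj_simps by (rule symI) (simp add: adj Int_commute)
  qed (simp_all add: adj)
  then show ?thesis
    by (simp add: G_def)
qed

text \<open>
  With all arc weights equal to \<open>1\<close>, the shortest-path cost \<open>\<mu>\<close> is the least length of a walk,
  and it is \<open>\<infinity>\<close> if there is no walk.
\<close>

definition graph_dist :: "'v pair_pre_digraph \<Rightarrow> 'v \<Rightarrow> 'v \<Rightarrow> ereal" where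
  "graph_dist G u v = wf_digraph.\<mu> (with_proj G) (\<lambda>_. 1) u v"

definition resolving_set :: "'v pair_pre_digraph \<Rightarrow> 'v set \<Rightarrow> bool" where
  "resolving_set G S \<longleftrightarrow> finite S \<and> S \<subseteq> pverts G \<and>
    (\<forall>u\<in>pverts G. \<forall>w\<in>pverts G. (\<forall>v\<in>S. graph_dist G u v = graph_dist G w v) \<longleftrightarrow> u = w)"

definition spread :: "nat \<Rightarrow> ('a::field ^ 'n) set \<Rightarrow> ('a ^ 'n) set set \<Rightarrow> bool" where
  "spread d V S \<longleftrightarrow> S \<subseteq> subspaces_of_dim d V \<and>
    (\<forall>v\<in>V. v \<noteq> 0 \<longrightarrow> (\<exists>!W. W \<in> S \<and> v \<in> W)) \<and>
    (\<forall>W\<in>S. \<forall>W'\<in>S. W \<noteq> W' \<longrightarrow> W \<inter> W' = {0})"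

end

theory Submission
  imports Defs
begin

text \<open>
  Call the $(k+1)$-dimensional subspaces $W_i$ and $X_j \oplus Z$ blocks.  The set $\mathcal M$
  consists of all hyperplanes of all blocks, and every vector of $V(n,q)$ lies in a block.

  In the Grassmann graph $d(A,U) = k - \dim(A \cap U)$ (\<open>grassmann_dist\<close>), so the distances
  from $A$ to $\mathcal M$ determine $\dim(A \cap U)$ for every hyperplane $U$ of every block $W$.
  Since $\dim A = k < \dim W$, the trace $A \cap W$ is a proper subspace of $W$.  Hence the largest
  value of $\dim(A \cap U)$ is $\dim(A \cap W)$, it is attained exactly by the hyperplanes $U$
  that contain $A \cap W$, and the intersection of these is $A \cap W$.  So the distances
  determine every trace $A \cap W$ (\<open>hyperplanes_resolve_trace\<close>).  The blocks cover the space,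
  so the traces determine $A$ (\<open>hyperplanes_of_cover_resolving\<close>).

  For the size, a block has at most $(q^{k+1}-1)/(q-1)$ hyperplanes, because each of them is the
  kernel of $q-1$ nonzero functionals (\<open>card_hyperplanes_le\<close>).  Counting nonzero vectors gives
  $|\mathcal S|\,(q^{k+1}-1) = q^s-1$ and $|\mathcal T|\,(q^t-1) = q^n-q^s$, so
  $|\mathcal T| = q^s$, and
  $|\mathcal M|\,(q-1) \le (q^s-1) + q^s(q^{k+1}-1) = q^{s+k+1}-1$.
\<close>

section \<open>Hyperplanes and functionals\<close>

text \<open>
  A basis of \<open>C\<close> followed by \<open>x\<close> extends to a basis of \<open>W\<close>; dropping \<open>x\<close> from it leaves a
  basis of \<open>U\<close>.
\<close>

lemma hyperplane_avoiding_vector: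
  fixes C W :: "('a::field ^ 'n) set"
  assumes C: "vec.subspace C" and W: "vec.subspace W" and "C \<subseteq> W" "x \<in> W" "x \<notin> C"
  obtains U where "vec.subspace U" "C \<subseteq> U" "U \<subseteq> W" "x \<notin> U" "vec.dim U + 1 = vec.dim W"
proof -
  obtain B where B: "B \<subseteq> C" "vec.independent B" "C \<subseteq> vec.span B"
    by (rule vec.basis_exists)
  have spB: "vec.span B = C"
    using B C by (simp add: vec.span_subspace)
  have "vec.independent (insert x B)"
    using B spB \<open>x \<notin> C\<close> by (simp add: vec.independent_insertI)
  moreover have "insert x B \<subseteq> W"
    using B assms by auto
  ultimately obtain D where D: "insert x B \<subseteq> D" "D \<subseteq> W" "vec.independent D" "W \<subseteq> vec.span D"
    using vec.maximal_independent_subset_extend by metis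
  have finD: "finite D"
    using D(3) by (rule vec.finiteI_independent)
  have spD: "vec.span D = W"
    using D W by (simp add: vec.span_subspace)
  have dimW: "vec.dim W = card D"
    using D(3) spD vec.dim_span_eq_card_independent by blast
  have ind: "vec.independent (D - {x})"
    using D(3) vec.independent_mono by blast
  show thesis
  proof
    show "vec.subspace (vec.span (D - {x}))" by simp
    have "x \<notin> B" using B \<open>x \<notin> C\<close> by blast
    then show "C \<subseteq> vec.span (D - {x})"
      unfolding spB[symmetric] using D(1) by (intro vec.span_mono) blast
    show "vec.span (D - {x}) \<subseteq> W"
      unfolding spD[symmetric] by (intro vec.span_mono) blast
    show "x \<notin> vec.span (D - {x})"
      using D(1,3) by (auto simp: vec.dependent_def)
    have "card (D - {x}) + 1 = card D"
      using D(1) finD by (metis Suc_eq_plus1 card_Suc_Diff1 insert_subset)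
    then show "vec.dim (vec.span (D - {x})) + 1 = vec.dim W"
      using dimW vec.dim_span_eq_card_independent[OF ind] by simp
  qed
qed

lemma dim_less_if_psubset:
  fixes U W :: "('a::field ^ 'n) set"
  assumes "vec.subspace U" "vec.subspace W" "U \<subset> W"
  shows "vec.dim U < vec.dim W"
  using assms vec.dim_psubset by (metis vec.span_eq_iff)

text \<open>
  For a vector \<open>w\<close> of \<open>W\<close> outside \<open>U\<close>, a basis of \<open>U\<close> together with \<open>w\<close> is a basis of \<open>W\<close>;
  the functional is the \<open>w\<close>-coordinate in an extension of it to the whole space.
\<close>

lemma hyperplane_functional:
  fixes U W :: "('a::field ^ 'n) set"
  assumes U: "vec.subspace U" and W: "vec.subspace W" and "U \<subseteq> W" "vec.dim U + 1 = vec.dim W"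
  obtains f :: "'a ^ 'n \<Rightarrow> 'a" where "Vector_Spaces.linear (*s) (*) f" "\<And>x. x \<in> W \<Longrightarrow> f x = 0 \<longleftrightarrow> x \<in> U"
proof -
  obtain B where B: "B \<subseteq> U" "vec.independent B" "U \<subseteq> vec.span B" "card B = vec.dim U"
    by (rule vec.basis_exists)
  have spB: "vec.span B = U"
    using B U by (simp add: vec.span_subspace)
  obtain w where w: "w \<in> W" "w \<notin> U"
    using assms by (metis add_cancel_right_right subset_antisym subsetI zero_neq_one)
  have indw: "vec.independent (insert w B)"
    using B spB w by (simp add: vec.independent_insertI)
  have spw: "vec.span (insert w B) = W"
  proof (rule vec.subspace_dim_equal)
    show "vec.span (insert w B) \<subseteq> W"
      using B w W \<open>U \<subseteq> W\<close> by (intro vec.span_minimal) auto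
    have "w \<notin> B" using B w by blast
    then have "card (insert w B) = card B + 1"
      using vec.finiteI_independent[OF B(2)] by simp
    then show "vec.dim W \<le> vec.dim (vec.span (insert w B))"
      using vec.dim_span_eq_card_independent[OF indw] B(4) assms(4) by simp
  qed (use W in auto)
  obtain D where D: "insert w B \<subseteq> D" "vec.independent D" "UNIV \<subseteq> vec.span D"
    using vec.maximal_independent_subset_extend[OF subset_UNIV indw] by metis
  define f where "f = (\<lambda>x. vec.representation D x w)"
  have lin: "Vector_Spaces.linear (*s) (*) f"
    unfolding f_def by (rule vec.linear_representation) (use D in auto)
  interpret f: Vector_Spaces.linear "(*s)" "(*)" f by (rule lin)
  have fw: "f w = 1"
    using D by (simp add: f_def vec.representation_basis)
  have fB: "f b = 0" if "b \<in> B" for b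
  proof -
    have "b \<in> D" "b \<noteq> w" using D B w that by auto
    then show ?thesis
      using D(2) by (simp add: f_def vec.representation_basis)
  qed
  have fU: "f x = 0" if "x \<in> U" for x
    using that unfolding spB[symmetric]
    by (induction rule: vec.span_induct_alt) (auto simp: f.add f.scale f.zero fB)
  show thesis
  proof (rule that[OF lin])
    fix x assume "x \<in> W"
    then obtain c where c: "x - c *s w \<in> U"
      using spw spB vec.span_breakdown_eq[of x w B] by auto
    then have "f x = c"
      using fU[OF c] fw by (simp add: f.diff f.scale)
    then show "f x = 0 \<longleftrightarrow> x \<in> U"
      using c fU by auto
  qed
qed

section \<open>Counting vectors and hyperplanes\<close>

lemma subspaces_of_dim_UNIV_iff:
  "U \<in> subspaces_of_dim k UNIV \<longleftrightarrow> vec.subspace U \<and> vec.dim U = k"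
  by (simp add: subspaces_of_dim_def)

lemma two_le_card_field: "2 \<le> CARD('a::{field,finite})"
proof -
  have "card {0, 1 :: 'a} \<le> CARD('a)"
    by (rule card_mono) auto
  then show ?thesis by simp
qed

lemma card_subspace:
  fixes W :: "('a::{field,finite} ^ 'n) set"
  assumes "vec.subspace W"
  shows "card W = CARD('a) ^ vec.dim W"
proof -
  obtain B where B: "B \<subseteq> W" "vec.independent B" "W \<subseteq> vec.span B" "card B = vec.dim W"
    by (rule vec.basis_exists)
  have spB: "vec.span B = W"
    using B assms by (simp add: vec.span_subspace)
  have fin: "finite B" by simp
  let ?c = "\<lambda>g. \<Sum>b\<in>B. g b *s b"
  have "bij_betw ?c (B \<rightarrow>\<^sub>E UNIV) W"
  proof (rule bij_betw_imageI)
    show "inj_on ?c (B \<rightarrow>\<^sub>E UNIV)"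
    proof (rule inj_onI)
      fix g h assume g: "g \<in> B \<rightarrow>\<^sub>E UNIV" and h: "h \<in> B \<rightarrow>\<^sub>E UNIV" and eq: "?c g = ?c h"
      have "(\<Sum>b\<in>B. (g b - h b) *s b) = 0"
        using eq by (simp add: vec.scale_left_diff_distrib sum_subtractf)
      then have "g b - h b = 0" if "b \<in> B" for b
        using vec.independentD[OF B(2) fin subset_refl, of "\<lambda>b. g b - h b"] that by blast
      then show "g = h" using g h by (intro PiE_ext) auto
    qed
    show "?c ` (B \<rightarrow>\<^sub>E UNIV) = W"
    proof
      show "?c ` (B \<rightarrow>\<^sub>E UNIV) \<subseteq> W"
        using B assms by (auto intro!: vec.subspace_sum vec.subspace_scale)
      show "W \<subseteq> ?c ` (B \<rightarrow>\<^sub>E UNIV)"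
      proof
        fix x assume "x \<in> W"
        then obtain u where "x = ?c u"
          using spB vec.span_finite[OF fin] by auto
        then have "x = ?c (restrict u B)" by simp
        moreover have "restrict u B \<in> B \<rightarrow>\<^sub>E UNIV" by simp
        ultimately show "x \<in> ?c ` (B \<rightarrow>\<^sub>E UNIV)" by (rule image_eqI)
      qed
    qed
  qed
  then have "card W = card (B \<rightarrow>\<^sub>E (UNIV :: 'a set))"
    by (simp add: bij_betw_same_card)
  then show ?thesis
    using B(4) by (simp add: card_PiE)
qed

text \<open>
  The nonzero multiples of a functional with kernel \<open>U\<close> are \<open>q - 1\<close> distinct nonzero
  functionals on \<open>W\<close>, and different hyperplanes give disjoint families.  A functional is encoded
  by its values on a basis \<open>B\<close> of \<open>W\<close>, so there are \<open>q ^ (d + 1) - 1\<close> nonzero ones.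
\<close>

lemma card_hyperplanes_le:
  fixes W :: "('a::{field,finite} ^ 'n) set"
  assumes W: "vec.subspace W" and "vec.dim W = d + 1"
  shows "card (subspaces_of_dim d W) * (CARD('a) - 1) \<le> CARD('a) ^ (d + 1) - 1"
proof -
  obtain B where B: "B \<subseteq> W" "vec.independent B" "W \<subseteq> vec.span B" "card B = vec.dim W"
    by (rule vec.basis_exists)
  have spB: "vec.span B = W"
    using B W by (simp add: vec.span_subspace)
  let ?H = "subspaces_of_dim d W"
  have "\<exists>f. Vector_Spaces.linear (*s) (*) f \<and> (\<forall>x\<in>W. f x = 0 \<longleftrightarrow> x \<in> U)" if "U \<in> ?H" for U
  proof -
    have "vec.subspace U" "U \<subseteq> W" "vec.dim U + 1 = vec.dim W"
      using that assms(2) by (auto simp: subspaces_of_dim_def)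
    then show ?thesis
      using hyperplane_functional[OF _ W] by metis
  qed
  then obtain F where lin: "\<And>U. U \<in> ?H \<Longrightarrow> Vector_Spaces.linear (*s) (*) (F U)"
    and ker: "\<And>U x. U \<in> ?H \<Longrightarrow> x \<in> W \<Longrightarrow> F U x = 0 \<longleftrightarrow> x \<in> U"
    by metis
  have sub: "U \<subseteq> W" "U \<noteq> W" if "U \<in> ?H" for U
    using that assms by (auto simp: subspaces_of_dim_def)
  (* Two functionals that agree on the basis agree on W. *)
  have agree: "c * F U x = c' * F U' x"
    if "U \<in> ?H" "U' \<in> ?H" "x \<in> W" "\<And>b. b \<in> B \<Longrightarrow> c * F U b = c' * F U' b" for U U' c c' x
  proof -
    interpret f: Vector_Spaces.linear "(*s)" "(*)" "F U" by (rule lin[OF that(1)])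
    interpret g: Vector_Spaces.linear "(*s)" "(*)" "F U'" by (rule lin[OF that(2)])
    from that(3) show ?thesis
      unfolding spB[symmetric]
    proof (induction rule: vec.span_induct_alt)
      case base show ?case by (simp add: f.zero g.zero)
    next
      case (step a b y)
      have "c * F U (a *s b + y) = a * (c * F U b) + c * F U y"
        by (simp add: f.add f.scale algebra_simps)
      also have "\<dots> = a * (c' * F U' b) + c' * F U' y"
        using step that(4) by simp
      also have "\<dots> = c' * F U' (a *s b + y)"
        by (simp add: g.add g.scale algebra_simps)
      finally show ?case .
    qed
  qed
  let ?\<Phi> = "\<lambda>(U, c). restrict (\<lambda>b. c * F U b) B"
  let ?Z = "restrict (\<lambda>b. 0) B :: 'a ^ 'n \<Rightarrow> 'a"
  have "inj_on ?\<Phi> (?H \<times> (UNIV - {0 :: 'a}))"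
  proof (rule inj_onI)
    fix p p' assume p: "p \<in> ?H \<times> (UNIV - {0 :: 'a})" and p': "p' \<in> ?H \<times> (UNIV - {0 :: 'a})" and "?\<Phi> p = ?\<Phi> p'"
    obtain U c U' c' where [simp]: "p = (U, c)" "p' = (U', c')" by fastforce
    have U: "U \<in> ?H" "U' \<in> ?H" and c: "c \<noteq> 0" "c' \<noteq> 0" using p p' by auto
    have "c * F U b = c' * F U' b" if "b \<in> B" for b
      using fun_cong[OF \<open>?\<Phi> p = ?\<Phi> p'\<close>, of b] that by simp
    note ag = agree[OF U _ this]
    (* Equal functionals have equal kernels, and a value off the kernel recovers the scalar. *)
    have "x \<in> U \<longleftrightarrow> x \<in> U'" if "x \<in> W" for x
      using ag[OF that] ker[OF U(1) that] ker[OF U(2) that] c by auto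
    then have UU: "U = U'" using sub U by blast
    obtain w where "w \<in> W" "w \<notin> U" using sub[OF U(1)] by blast
    then have "c = c'" using ag[of w] ker[OF U(1)] UU by auto
    with UU show "p = p'" by simp
  qed
  moreover have "?\<Phi> ` (?H \<times> (UNIV - {0 :: 'a})) \<subseteq> (B \<rightarrow>\<^sub>E UNIV) - {?Z}"
  proof (rule image_subsetI)
    fix p assume p: "p \<in> ?H \<times> (UNIV - {0 :: 'a})"
    obtain U c where [simp]: "p = (U, c)" by fastforce
    have U: "U \<in> ?H" and "c \<noteq> 0" using p by auto
    have "restrict (\<lambda>b. c * F U b) B \<noteq> ?Z"
    proof
      assume eq: "restrict (\<lambda>b. c * F U b) B = ?Z"
      have "c * F U b = 0 * F U b" if "b \<in> B" for b
        using fun_cong[OF eq, of b] that by simp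
      from agree[OF U U _ this] have "W \<subseteq> U"
        using ker[OF U] \<open>c \<noteq> 0\<close> by auto
      with sub[OF U] show False by blast
    qed
    then show "?\<Phi> p \<in> (B \<rightarrow>\<^sub>E UNIV) - {?Z}" by simp
  qed
  ultimately have "card (?H \<times> (UNIV - {0 :: 'a})) \<le> card ((B \<rightarrow>\<^sub>E UNIV) - {?Z})"
    by (intro card_inj_on_le) (auto intro: finite_PiE)
  also have "\<dots> = CARD('a) ^ (d + 1) - 1"
    using B(4) assms(2) by (subst card_Diff_singleton) (auto simp: card_PiE)
  finally show ?thesis by (simp add: card_cartesian_product card_Diff_singleton)
qed

lemma card_hyperplanes_of_family_le:
  fixes \<B> :: "('a::{field,finite} ^ 'n) set set"
  assumes "\<B> \<subseteq> subspaces_of_dim (k + 1) UNIV"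
  shows "card (\<Union>W\<in>\<B>. subspaces_of_dim k W) * (CARD('a) - 1) \<le> card \<B> * (CARD('a) ^ (k + 1) - 1)"
proof -
  have "card (\<Union>W\<in>\<B>. subspaces_of_dim k W) * (CARD('a) - 1)
      \<le> (\<Sum>W\<in>\<B>. card (subspaces_of_dim k W)) * (CARD('a) - 1)"
    by (intro mult_right_mono card_UN_le) auto
  also have "\<dots> = (\<Sum>W\<in>\<B>. card (subspaces_of_dim k W) * (CARD('a) - 1))"
    by (simp add: sum_distrib_right)
  also have "\<dots> \<le> (\<Sum>W\<in>\<B>. CARD('a) ^ (k + 1) - 1)"
    using assms by (intro sum_mono card_hyperplanes_le) (auto simp: subspaces_of_dim_UNIV_iff)
  finally show ?thesis by simp
qed

lemma card_subspaces_partition: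
  fixes P :: "('a::{field,finite} ^ 'n) set set"
  assumes P: "P \<subseteq> subspaces_of_dim d UNIV"
    and disj: "\<And>X Y. X \<in> P \<Longrightarrow> Y \<in> P \<Longrightarrow> X \<noteq> Y \<Longrightarrow> X \<inter> Y \<subseteq> {0}"
  shows "card (\<Union>X\<in>P. X - {0}) = card P * (CARD('a) ^ d - 1)"
proof -
  have "card (X - {0}) = CARD('a) ^ d - 1" if "X \<in> P" for X
  proof -
    have X: "vec.subspace X" "vec.dim X = d"
      using that P by (auto simp: subspaces_of_dim_UNIV_iff)
    then have "0 \<in> X" by (simp add: vec.subspace_0)
    then show ?thesis using card_subspace[OF X(1)] X(2) by (simp add: card_Diff_singleton)
  qed
  moreover have "card (\<Union>X\<in>P. X - {0}) = (\<Sum>X\<in>P. card (X - {0}))"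
    by (rule card_UN_disjoint) (use disj in auto)
  ultimately show ?thesis by simp
qed

section \<open>Distance in the Grassmann graph\<close>

lemma pverts_grassmann_graph: "pverts (grassmann_graph k) = subspaces_of_dim k UNIV"
  by (simp add: grassmann_graph_def)

lemma parcs_grassmann_graph_iff:
  "(X, Y) \<in> parcs (grassmann_graph k) \<longleftrightarrow>
    X \<in> subspaces_of_dim k UNIV \<and> Y \<in> subspaces_of_dim k UNIV \<and> vec.dim (X \<inter> Y) + 1 = k"
  by (simp add: grassmann_graph_def)

text \<open>
  The sum of \<open>X \<inter> Y\<close> and \<open>Y \<inter> Z\<close> lies in \<open>Y\<close>, and their intersection lies in \<open>X \<inter> Z\<close>.  When
  \<open>X\<close> and \<open>Y\<close> are adjacent vertices, this says that moving from \<open>Y\<close> to \<open>X\<close> lowers the dimension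
  of the intersection with \<open>Z\<close> by at most one.
\<close>

lemma dim_Int_modular:
  fixes X Y Z :: "('a::field ^ 'n) set"
  assumes "vec.subspace X" "vec.subspace Y" "vec.subspace Z"
  shows "vec.dim (X \<inter> Y) + vec.dim (Y \<inter> Z) \<le> vec.dim (X \<inter> Z) + vec.dim Y"
proof -
  let ?P = "X \<inter> Y" and ?Q = "Y \<inter> Z"
  have P: "vec.subspace ?P" and Q: "vec.subspace ?Q"
    using assms by (simp_all add: vec.subspace_inter)
  have "vec.dim {x + y |x y. x \<in> ?P \<and> y \<in> ?Q} \<le> vec.dim Y"
    using assms by (intro vec.dim_subset) (auto intro: vec.subspace_add)
  moreover have "vec.dim (?P \<inter> ?Q) \<le> vec.dim (X \<inter> Z)"
    by (intro vec.dim_subset) auto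
  ultimately show ?thesis
    using vec.dim_sums_Int[OF P Q] by linarith
qed

lemma grassmann_walk_length_ge:
  fixes X Y :: "('a::{field,finite} ^ 'n) set"
  assumes "pre_digraph.awalk (with_proj (grassmann_graph k)) X p Y"
  shows "k \<le> length p + vec.dim (X \<inter> Y)"
proof -
  interpret G: pair_graph "grassmann_graph k :: ('a ^ 'n) set pair_pre_digraph"
    by (rule pair_graph_grassmann_graph)
  have Y: "vec.subspace Y"
    using G.awalk_last_in_verts[OF assms]
    by (simp add: pverts_grassmann_graph subspaces_of_dim_UNIV_iff)
  from assms show ?thesis
  proof (induction p arbitrary: X)
    case Nil
    then show ?case
      by (auto simp: G.awalk_Nil_iff pverts_grassmann_graph subspaces_of_dim_UNIV_iff)
  next
    case (Cons e p)
    obtain X' where e: "e = (X, X')" "(X, X') \<in> parcs (grassmann_graph k)"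
      "G.awalk X' p Y"
      using Cons.prems by (cases e) (auto simp: G.awalk_Cons_iff)
    have "vec.subspace X" "vec.subspace X'" "vec.dim X' = k" "vec.dim (X \<inter> X') + 1 = k"
      using e(2) by (auto simp: parcs_grassmann_graph_iff subspaces_of_dim_UNIV_iff)
    then show ?case
      using dim_Int_modular[of X X' Y] Y Cons.IH[OF e(3)] by simp
  qed
qed

text \<open>
  If \<open>X \<noteq> Y\<close>, some neighbour of \<open>X\<close> meets \<open>Y\<close> in a larger space, so induction on \<open>m\<close>
  applies: take a hyperplane \<open>H\<close> of \<open>X\<close> that contains \<open>X \<inter> Y\<close>, and span it together with a
  vector of \<open>Y\<close> outside \<open>X\<close>.
\<close>

lemma grassmann_walk_exists:
  fixes X Y :: "('a::{field,finite} ^ 'n) set"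
  assumes "X \<in> subspaces_of_dim k UNIV" "Y \<in> subspaces_of_dim k UNIV"
    and "k \<le> m + vec.dim (X \<inter> Y)"
  shows "\<exists>p. pre_digraph.awalk (with_proj (grassmann_graph k)) X p Y \<and> length p \<le> m"
proof -
  interpret G: pair_graph "grassmann_graph k :: ('a ^ 'n) set pair_pre_digraph"
    by (rule pair_graph_grassmann_graph)
  have Y: "vec.subspace Y" "vec.dim Y = k"
    using assms by (auto simp: subspaces_of_dim_UNIV_iff)
  show ?thesis using assms(1,3)
  proof (induction m arbitrary: X)
    case 0
    then have X: "vec.subspace X" "vec.dim X = k" "k \<le> vec.dim (X \<inter> Y)"
      by (auto simp: subspaces_of_dim_UNIV_iff)
    then have "X \<inter> Y = X" "X \<inter> Y = Y"
      using Y by (intro vec.subspace_dim_equal vec.subspace_inter; simp)+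
    then have "G.awalk X [] Y"
      using assms(2) by (simp add: G.awalk_Nil_iff pverts_grassmann_graph)
    then show ?case by force
  next
    case (Suc m)
    have X: "vec.subspace X" "vec.dim X = k"
      using Suc.prems by (auto simp: subspaces_of_dim_UNIV_iff)
    show ?case
    proof (cases "X = Y")
      case True
      then have "G.awalk X [] Y"
        using assms(2) by (simp add: G.awalk_Nil_iff pverts_grassmann_graph)
      then show ?thesis by force
    next
      case False
      then have "\<not> X \<subseteq> Y" "\<not> Y \<subseteq> X"
        using X Y vec.subspace_dim_equal by (metis order_refl)+
      then obtain x y where x: "x \<in> X" "x \<notin> Y" and y: "y \<in> Y" "y \<notin> X" by blast
      have I: "vec.subspace (X \<inter> Y)"
        using X Y by (simp add: vec.subspace_inter)
      obtain H where H: "vec.subspace H" "X \<inter> Y \<subseteq> H" "H \<subseteq> X" "vec.dim H + 1 = k"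
        using hyperplane_avoiding_vector[OF I X(1)] x X(2) by (metis IntD2 Int_lower1)
      let ?X = "vec.span (insert y H)"
      have yH: "y \<notin> vec.span H"
        using H y by (metis subsetD vec.span_eq_iff)
      have X': "vec.subspace ?X" "vec.dim ?X = k"
        using H yH by (simp_all add: vec.dim_insert)
      have y': "y \<in> ?X" by (simp add: vec.span_base)
      have HX': "H \<subseteq> ?X" by (meson order_trans subset_insertI vec.span_superset)
      have "vec.dim (X \<inter> ?X) + 1 = k"
      proof -
        have "vec.dim H \<le> vec.dim (X \<inter> ?X)"
          using H HX' by (intro vec.dim_subset) auto
        moreover have "vec.dim (X \<inter> ?X) < vec.dim ?X"
          using X X' y y' by (intro dim_less_if_psubset vec.subspace_inter) auto
        ultimately show ?thesis using H X' by simp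
      qed
      then have arc: "(X, ?X) \<in> parcs (grassmann_graph k)"
        using Suc.prems(1) X' by (simp add: parcs_grassmann_graph_iff subspaces_of_dim_UNIV_iff)
      have "vec.dim (X \<inter> Y) < vec.dim (?X \<inter> Y)"
        using X X' Y H HX' y y' by (intro dim_less_if_psubset vec.subspace_inter) auto
      then have "k \<le> m + vec.dim (?X \<inter> Y)"
        using Suc.prems(2) by simp
      then obtain p where p: "G.awalk ?X p Y" "length p \<le> m"
        using Suc.IH X' by (metis subspaces_of_dim_UNIV_iff)
      have "G.awalk X ((X, ?X) # p) Y"
        using arc p(1) Suc.prems(1) by (simp add: G.awalk_Cons_iff pverts_grassmann_graph)
      with p(2) show ?thesis by (metis Suc_le_mono length_Cons)
    qed
  qed
qed

lemma grassmann_dist: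
  fixes X Y :: "('a::{field,finite} ^ 'n) set"
  assumes "X \<in> subspaces_of_dim k UNIV" "Y \<in> subspaces_of_dim k UNIV"
  shows "graph_dist (grassmann_graph k) X Y = ereal (real (k - vec.dim (X \<inter> Y)))"
proof -
  interpret G: pair_graph "grassmann_graph k :: ('a ^ 'n) set pair_pre_digraph"
    by (rule pair_graph_grassmann_graph)
  have cost: "G.awalk_cost (\<lambda>_. 1) p = real (length p)" for p
    by (simp add: G.awalk_cost_def sum_list_triv)
  show ?thesis
    unfolding graph_dist_def
  proof (rule antisym)
    have "k \<le> k - vec.dim (X \<inter> Y) + vec.dim (X \<inter> Y)" by simp
    then obtain p where p: "G.awalk X p Y" "length p \<le> k - vec.dim (X \<inter> Y)"
      using grassmann_walk_exists[OF assms] by blast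
    show "G.\<mu> (\<lambda>_. 1) X Y \<le> ereal (real (k - vec.dim (X \<inter> Y)))"
      using G.min_cost_le_walk_cost[OF p(1), of "\<lambda>_. 1"] p(2) 
      by (simp add: cost) (meson ereal_less_eq(3) of_nat_le_iff order_trans)
    show "ereal (real (k - vec.dim (X \<inter> Y))) \<le> G.\<mu> (\<lambda>_. 1) X Y"
      unfolding G.\<mu>_def
    proof (rule INF_greatest, clarify)
      fix p assume "G.awalk X p Y"
      then have "k \<le> length p + vec.dim (X \<inter> Y)"
        by (rule grassmann_walk_length_ge)
      then show "ereal (real (k - vec.dim (X \<inter> Y))) \<le> ereal (G.awalk_cost (\<lambda>_. 1) p)"
        by (simp add: cost)
    qed
  qed
qed

section \<open>Hyperplanes of a covering family resolve the graph\<close>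

text \<open>
  The trace \<open>A \<inter> W\<close> is proper in \<open>W\<close>, so some hyperplane of \<open>W\<close> contains it; comparing there,
  and symmetrically for \<open>B\<close>, shows that both traces have the same dimension.  A vector of
  \<open>A \<inter> W\<close> outside \<open>B\<close> would be missed by a hyperplane \<open>U\<close> containing \<open>B \<inter> W\<close>, and then
  \<open>A \<inter> U\<close> would be smaller than \<open>A \<inter> W\<close> while \<open>B \<inter> U\<close> is all of \<open>B \<inter> W\<close>.
\<close>

lemma hyperplanes_resolve_trace:
  fixes A B W :: "('a::field ^ 'n) set"
  assumes A: "vec.subspace A" "vec.dim A = k" and B: "vec.subspace B" "vec.dim B = k"
    and W: "vec.subspace W" "vec.dim W = k + 1"
    and eq: "\<And>U. U \<in> subspaces_of_dim k W \<Longrightarrow> vec.dim (A \<inter> U) = vec.dim (B \<inter> U)"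
  shows "A \<inter> W \<subseteq> B"
proof
  have sub: "vec.subspace (A \<inter> W)" "vec.subspace (B \<inter> W)"
    using assms by (simp_all add: vec.subspace_inter)
  have le: "vec.dim (C \<inter> W) \<le> vec.dim (D \<inter> W)"
    if C: "vec.subspace C" "vec.dim C = k"
      and eqC: "\<And>U. U \<in> subspaces_of_dim k W \<Longrightarrow> vec.dim (C \<inter> U) = vec.dim (D \<inter> U)" for C D
  proof -
    have "C \<inter> W \<noteq> W"
    proof
      assume "C \<inter> W = W"
      then have "vec.dim W \<le> vec.dim C" by (intro vec.dim_subset) auto
      then show False using W C by simp
    qed
    then obtain x where x: "x \<in> W" "x \<notin> C \<inter> W" by blast
    obtain U where U: "vec.subspace U" "C \<inter> W \<subseteq> U" "U \<subseteq> W" "vec.dim U + 1 = vec.dim W"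
      using hyperplane_avoiding_vector[OF vec.subspace_inter[OF C(1) W(1)] W(1) Int_lower2 x] .
    have "C \<inter> U = C \<inter> W" using U by blast
    moreover have "vec.dim (D \<inter> U) \<le> vec.dim (D \<inter> W)"
      using U by (intro vec.dim_subset) auto
    moreover have "U \<in> subspaces_of_dim k W"
      using U W by (simp add: subspaces_of_dim_def)
    ultimately show ?thesis using eqC by metis
  qed
  have dims: "vec.dim (A \<inter> W) = vec.dim (B \<inter> W)"
    using le[OF A eq] le[OF B eq[symmetric]] by simp
  fix x assume x: "x \<in> A \<inter> W"
  show "x \<in> B"
  proof (rule ccontr)
    assume "x \<notin> B"
    then obtain U where U: "vec.subspace U" "B \<inter> W \<subseteq> U" "U \<subseteq> W" "x \<notin> U" "vec.dim U + 1 = vec.dim W"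
      using hyperplane_avoiding_vector[OF sub(2) W(1) Int_lower2] x by (metis IntD1 IntD2)
    have "B \<inter> U = B \<inter> W" using U by blast
    moreover have "vec.dim (A \<inter> U) < vec.dim (A \<inter> W)"
      using U x sub A W by (intro dim_less_if_psubset vec.subspace_inter) auto
    moreover have "U \<in> subspaces_of_dim k W"
      using U W by (simp add: subspaces_of_dim_def)
    ultimately show False using eq[of U] dims by simp
  qed
qed

lemma hyperplanes_of_cover_resolving:
  fixes \<B> :: "('a::{field,finite} ^ 'n) set set"
  assumes \<B>: "\<B> \<subseteq> subspaces_of_dim (k + 1) UNIV" and cover: "\<And>x. x \<noteq> 0 \<Longrightarrow> x \<in> \<Union>\<B>"
  shows "resolving_set (grassmann_graph k) (\<Union>W\<in>\<B>. subspaces_of_dim k W)"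
  unfolding resolving_set_def pverts_grassmann_graph
proof (intro conjI ballI iffI)
  let ?M = "\<Union>W\<in>\<B>. subspaces_of_dim k W"
  show "finite ?M" by simp
  show M: "?M \<subseteq> subspaces_of_dim k UNIV"
    by (auto simp: subspaces_of_dim_def)
  fix A B :: "('a ^ 'n) set"
  assume A: "A \<in> subspaces_of_dim k UNIV" and B: "B \<in> subspaces_of_dim k UNIV"
  {
    assume eq: "\<forall>U\<in>?M. graph_dist (grassmann_graph k) A U = graph_dist (grassmann_graph k) B U"
    have dims: "vec.dim (A \<inter> U) = vec.dim (B \<inter> U)" if "U \<in> ?M" for U
    proof -
      have U: "U \<in> subspaces_of_dim k UNIV" using M that by blast
      have "vec.dim (A \<inter> U) \<le> vec.dim U" "vec.dim (B \<inter> U) \<le> vec.dim U"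
        by (intro vec.dim_subset Int_lower2)+
      then show ?thesis
        using bspec[OF eq that] A B U
        by (simp add: grassmann_dist subspaces_of_dim_UNIV_iff)
    qed
    have sub: "C \<subseteq> D" if C: "C \<in> subspaces_of_dim k UNIV" and D: "D \<in> subspaces_of_dim k UNIV"
      and CD: "\<And>U. U \<in> ?M \<Longrightarrow> vec.dim (C \<inter> U) = vec.dim (D \<inter> U)" for C D
    proof
      fix x assume "x \<in> C"
      show "x \<in> D"
      proof (cases "x = 0")
        case True
        then show ?thesis using D by (simp add: subspaces_of_dim_UNIV_iff vec.subspace_0)
      next
        case False
        then obtain W where W: "W \<in> \<B>" "x \<in> W" using cover by blast
        have "C \<inter> W \<subseteq> D"
        proof (rule hyperplanes_resolve_trace)
          show "vec.dim (C \<inter> U) = vec.dim (D \<inter> U)" if "U \<in> subspaces_of_dim k W" for U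
            using CD that W(1) by blast
        qed (use C D W(1) \<B> in \<open>auto simp: subspaces_of_dim_UNIV_iff\<close>)
        then show ?thesis using \<open>x \<in> C\<close> W(2) by blast
      qed
    qed
    show "A = B"
      using sub[OF A B dims] sub[OF B A dims[symmetric]] by blast
  }
qed simp

section \<open>Blocks from a spread and its complement\<close>

theorem proposition11:
  fixes k s t n q :: nat
    and Vs Z :: "('a::{field,finite} ^ 'n) set"
    and \<S> \<T> \<M> :: "('a ^ 'n) set set"
  assumes "q = CARD('a)" and "n = CARD('n)"
    and "k \<ge> 2"
    and "n = s + t" and "s > 0" and "(k + 1) dvd s" and "0 < t" and "t < k + 1"
    and "vec.subspace Vs" and "vec.dim Vs = s"
    and "partition_on (UNIV - {0}) ((\<lambda>X. X - {0}) ` (\<S> \<union> \<T>))"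
    and "spread (k + 1) Vs \<S>"
    and "\<T> \<subseteq> subspaces_of_dim t UNIV"
    and "partition_on (UNIV - Vs) ((\<lambda>X. X - {0}) ` \<T>)"
    and "vec.subspace Z" and "Z \<subseteq> Vs" and "vec.dim Z = k - t + 1"
    and "\<M> = (\<Union>W\<in>\<S>. subspaces_of_dim k W)
             \<union> (\<Union>X\<in>\<T>. subspaces_of_dim k {x + z |x z. x \<in> X \<and> z \<in> Z})"
  shows "resolving_set (grassmann_graph k) \<M>
    \<and> real (card \<M>) \<le> (real q ^ ((n - t) + (k + 1)) - 1) / (real q - 1)"
proof -
  define J where "J X = {x + z |x z. x \<in> X \<and> z \<in> Z}" for X
  define \<B> where "\<B> = \<S> \<union> J ` \<T>"
  have q: "q \<ge> 2" using assms(1) two_le_card_field by simp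
  have Vs0: "0 \<in> Vs" and Z0: "0 \<in> Z"
    using assms(9,15) by (simp_all add: vec.subspace_0)
  have S: "\<S> \<subseteq> subspaces_of_dim (k + 1) UNIV" "\<And>W. W \<in> \<S> \<Longrightarrow> W \<subseteq> Vs"
    and S_cover: "\<And>x. x \<in> Vs \<Longrightarrow> x \<noteq> 0 \<Longrightarrow> \<exists>W\<in>\<S>. x \<in> W"
    and S_disj: "\<And>W W'. W \<in> \<S> \<Longrightarrow> W' \<in> \<S> \<Longrightarrow> W \<noteq> W' \<Longrightarrow> W \<inter> W' \<subseteq> {0}"
    using assms(12) unfolding spread_def subspaces_of_dim_def by auto
  have T: "vec.subspace X" "vec.dim X = t" if "X \<in> \<T>" for X
    using that assms(13) by (auto simp: subspaces_of_dim_UNIV_iff)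
  have T_Un: "(\<Union>X\<in>\<T>. X - {0}) = UNIV - Vs"
    using partition_onD1[OF assms(14)] by simp
  (* The partition consists of the sets X - {0}; distinct subspaces X give distinct such sets. *)
  have T_disj: "X \<inter> Y \<subseteq> {0}" if "X \<in> \<T>" "Y \<in> \<T>" "X \<noteq> Y" for X Y
  proof -
    have "X - {0} \<noteq> Y - {0}"
      using that T(1)[THEN vec.subspace_0] by (metis insert_Diff)
    then have "(X - {0}) \<inter> (Y - {0}) = {}"
      using that by (intro disjointD[OF partition_onD2[OF assms(14)]]) auto
    then show ?thesis by blast
  qed

  have J: "J X \<in> subspaces_of_dim (k + 1) UNIV" "X \<subseteq> J X" if "X \<in> \<T>" for X
  proof -
    have "X \<inter> Z = {0}"
      using T_Un that assms(16) Z0 T(1)[OF that, THEN vec.subspace_0] by blast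
    then have "vec.dim (J X) = k + 1"
      using vec.dim_sums_Int[OF T(1)[OF that] assms(15)] T(2)[OF that] assms(8,17)
      by (simp add: J_def)
    then show "J X \<in> subspaces_of_dim (k + 1) UNIV"
      using vec.subspace_sums[OF T(1)[OF that] assms(15)]
      by (simp add: J_def subspaces_of_dim_UNIV_iff)
    show "X \<subseteq> J X"
      using Z0 unfolding J_def by force
  qed
  have \<B>: "\<B> \<subseteq> subspaces_of_dim (k + 1) UNIV"
    using S(1) J(1) by (auto simp: \<B>_def)
  have cover: "x \<in> \<Union>\<B>" if "x \<noteq> 0" for x
  proof (cases "x \<in> Vs")
    case True
    then show ?thesis using S_cover that by (auto simp: \<B>_def)
  next
    case False
    then obtain X where "X \<in> \<T>" "x \<in> X" using T_Un by blast
    then show ?thesis using J(2) by (auto simp: \<B>_def)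
  qed
  have \<M>: "\<M> = (\<Union>W\<in>\<B>. subspaces_of_dim k W)"
    unfolding assms(18) \<B>_def J_def by blast

  have "(\<Union>W\<in>\<S>. W - {0}) = Vs - {0}"
    using S(2) S_cover by blast
  then have card_S: "card \<S> * (q ^ (k + 1) - 1) = q ^ s - 1"
    using card_subspaces_partition[OF S(1) S_disj] card_subspace[OF assms(9)] Vs0 assms(1,10)
    by (simp add: card_Diff_singleton)
  have "card (UNIV - Vs) = q ^ n - q ^ s"
    using card_subspace[OF assms(9)] assms(1,2,10) by (simp add: card_Diff_subset)
  then have "card \<T> * (q ^ t - 1) = q ^ n - q ^ s"
    using card_subspaces_partition[OF assms(13) T_disj] T_Un assms(1) by simp
  also have "\<dots> = q ^ s * (q ^ t - 1)"
    using assms(4) by (simp add: power_add diff_mult_distrib2)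
  finally have card_T: "card \<T> = q ^ s"
    using one_less_power[of q t] q assms(7) by simp
  have "card \<M> * (q - 1) \<le> card \<B> * (q ^ (k + 1) - 1)"
    using card_hyperplanes_of_family_le[OF \<B>] \<M> assms(1) by simp
  also have "\<dots> \<le> (card \<S> + card \<T>) * (q ^ (k + 1) - 1)"
    unfolding \<B>_def
    by (intro mult_right_mono order_trans[OF card_Un_le] add_left_mono card_image_le) auto
  also have "\<dots> = (q ^ s - 1) + q ^ s * (q ^ (k + 1) - 1)"
    using card_S card_T by (simp add: add_mult_distrib)
  also have "\<dots> = q ^ (s + (k + 1)) - 1"
    using q by (simp add: power_add diff_mult_distrib2 mult.left_commute)
  finally have "real (card \<M> * (q - 1)) \<le> real (q ^ (s + (k + 1)) - 1)"
    by (simp only: of_nat_le_iff)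
  then have "real (card \<M>) * (real q - 1) \<le> real q ^ (s + (k + 1)) - 1"
    using q by (simp add: of_nat_diff)
  then have "real (card \<M>) \<le> (real q ^ ((n - t) + (k + 1)) - 1) / (real q - 1)"
    using q assms(4) by (simp add: pos_le_divide_eq)
  moreover have "resolving_set (grassmann_graph k) \<M>"
    unfolding \<M> by (rule hyperplanes_of_cover_resolving[OF \<B> cover])
  ultimately show ?thesis by simp
qed

end
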